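(* For any $D<-2$ there exists a Lebesgue measurable set $\Omega\subseteq\mathbb{R}^2$ of finite Lebesgue measure such that $\Omega$ is maximally hyperfractal at infinity with $\dim_B(\infty,\Omega)=D$ and Minkowski nondegenerate at infinity.
   Context: $|\cdot|$ denotes the Euclidean norm of a vector in $\mathbb{R}^N$ and the $N$-dimensional Lebesgue measure of a set (here $N=2$). For $t>0$, ${}_t\Omega:=B_t(0)^c\cap\Omega$, where $B_t(0)$ is the open Euclidean ball of radius $t$ centered at $0$. For $r\in\mathbb{R}$, the upper and lower $r$-dimensional Minkowski contents of $\Omega$ at infinity, $\overline{\mathcal M}^r(\infty,\Omega)$ and $\underline{\mathcal M}^r(\infty,\Omega)$, are the $\limsup$ and $\liminf$ of $|{}_t\Omega|/t^{N+r}$ as $t\to+\infty$. The upper (lower) Minkowski dimension $\overline{\dim}_B(\infty,\Omega)$ ($\underline{\dim}_B(\infty,\Omega)$) is the infimum of all $r\in\mathbb{R}$ for which the upper (lower) $r$-dimensional content is $0$; if both coincide the common value is $\dim_B(\infty,\Omega)$. $\Omega$ is Minkowski nondegenerate at infinity if $0<\underline{\mathcal M}^D(\infty,\Omega)\le\overline{\mathcal M}^D(\infty,\Omega)<\infty$ for some $D$ (necessarily $D=\dim_B(\infty,\Omega)$). The distance zeta function at infinity is $\zeta_{\infty,\Omega}(s):=\int_{{}_T\Omega}|x|^{-s-N}\,dx$ for a fixed $T>0$; it is holomorphic on $\{\operatorname{Re}s>\overline{\dim}_B(\infty,\Omega)\}$ and changing $T$ only adds an entire function. $\Omega$ is maximally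 hyperfractal at infinity if the critical line $\{\operatorname{Re}s=\overline{\dim}_B(\infty,\Omega)\}$ is a natural boundary of $\zeta_{\infty,\Omega}$, i.e., every point of this line is a nonremovable singularity of $\zeta_{\infty,\Omega}$ (there is no neighborhood of the point to which $\zeta_{\infty,\Omega}$ extends holomorphically from the half-plane). *)

theory Defs
  imports "HOL-Complex_Analysis.Complex_Analysis"
begin

definition tail_at_infinity :: "real \<Rightarrow> 'a::euclidean_space set \<Rightarrow> 'a set" where
  "tail_at_infinity t \<Omega> = - ball 0 t \<inter> \<Omega>"

definition upper_minkowski_content_inf :: "real \<Rightarrow> 'a::euclidean_space set \<Rightarrow> ennreal" where
  "upper_minkowski_content_inf r \<Omega> =
     Limsup at_top (\<lambda>t::real. emeasure lebesgue (tail_at_infinity t \<Omega>) /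
                              ennreal (t powr (real DIM('a) + r)))"

definition lower_minkowski_content_inf :: "real \<Rightarrow> 'a::euclidean_space set \<Rightarrow> ennreal" where
  "lower_minkowski_content_inf r \<Omega> =
     Liminf at_top (\<lambda>t::real. emeasure lebesgue (tail_at_infinity t \<Omega>) /
                              ennreal (t powr (real DIM('a) + r)))"

text \<open>The exponents range over all (also negative) reals, so the infima are taken in
  the extended reals: \<open>- \<infinity>\<close> is possible, and \<open>\<infinity>\<close> is the infimum of the empty set.\<close>

definition upper_minkowski_dim_inf :: "'a::euclidean_space set \<Rightarrow> ereal" where
  "upper_minkowski_dim_inf \<Omega> = Inf (ereal ` {r. upper_minkowski_content_inf r \<Omega> = 0})"

definition lower_minkowski_dim_inf :: "'a::euclidean_space set \<Rightarrow> ereal" where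
  "lower_minkowski_dim_inf \<Omega> = Inf (ereal ` {r. lower_minkowski_content_inf r \<Omega> = 0})"

definition has_minkowski_dim_inf :: "'a::euclidean_space set \<Rightarrow> ereal \<Rightarrow> bool" where
  "has_minkowski_dim_inf \<Omega> d \<longleftrightarrow>
     upper_minkowski_dim_inf \<Omega> = d \<and> lower_minkowski_dim_inf \<Omega> = d"

definition minkowski_nondegenerate_inf :: "'a::euclidean_space set \<Rightarrow> bool" where
  "minkowski_nondegenerate_inf \<Omega> \<longleftrightarrow>
     (\<exists>D. 0 < lower_minkowski_content_inf D \<Omega> \<and>
          lower_minkowski_content_inf D \<Omega> \<le> upper_minkowski_content_inf D \<Omega> \<and>
          upper_minkowski_content_inf D \<Omega> < \<infinity>)"

text \<open>Only the values at arguments with real part greater than the upper dimension are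
  meaningful; the integral is \<open>0\<close> by convention where it does not converge absolutely.\<close>

definition distance_zeta_inf :: "real \<Rightarrow> 'a::euclidean_space set \<Rightarrow> complex \<Rightarrow> complex" where
  "distance_zeta_inf T \<Omega> s =
     set_lebesgue_integral lebesgue (tail_at_infinity T \<Omega>)
       (\<lambda>x. complex_of_real (norm x) powr (- s - of_nat DIM('a)))"

text \<open>The critical line is required to exist, that is, the upper dimension must be finite.
  The cutoff \<open>T\<close> is kept as a parameter, although the notion does not depend on \<open>T > 0\<close>.\<close>

definition maximally_hyperfractal_inf :: "real \<Rightarrow> 'a::euclidean_space set \<Rightarrow> bool" where
  "maximally_hyperfractal_inf T \<Omega> \<longleftrightarrow>
     (\<exists>d::real. upper_minkowski_dim_inf \<Omega> = ereal d \<and>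
        (\<forall>s0. Re s0 = d \<longrightarrow>
           \<not> (\<exists>U g. open U \<and> s0 \<in> U \<and> g holomorphic_on U \<and>
                    (\<forall>s\<in>U. Re s > d \<longrightarrow> g s = distance_zeta_inf T \<Omega> s))))"

end

theory Submission
  imports Defs
begin

text \<open>The set is a union of thin circular shells: the \<open>n\<close>-th shell has inner radius
  \<open>a\<^sub>n = exp n\<close> and area \<open>V\<^sub>n = c\<^sub>n exp ((2 + D) n)\<close>, where \<open>c\<^sub>n = 2\<close> if \<open>n\<close> is a power of two
  and \<open>c\<^sub>n = 1\<close> otherwise. Since \<open>c\<^sub>n\<close> stays between two positive constants, the area
  outside the disc of radius \<open>t\<close> lies between two positive multiples of \<open>t powr (2 + D)\<close>. Such a
  two-sided bound gives dimension \<open>D\<close> and nondegeneracy at once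
  (\<open>powr_tail_bounds_imp_minkowski_dim_inf\<close>), and at \<open>t = 1\<close> it gives finite area.

  The shells are so thin that replacing \<open>norm x\<close> by \<open>a\<^sub>n\<close> in the integrand of the zeta function
  costs only a bounded amount on a horizontal segment ending at the critical line. What remains is
  \<open>(\<Sum>n. V\<^sub>n * a\<^sub>n powr (- s - 2)) = (\<Sum>n. c\<^sub>n * w ^ n)\<close> with \<open>w = exp (D - s)\<close>, and the critical
  line is mapped to the unit circle (\<open>distance_zeta_shell_union_lacunary\<close>). Subtracting the
  geometric series, whose real part is nonnegative in the unit disc, leaves the lacunary series
  \<open>(\<Sum>k. w ^ 2 ^ k)\<close>. Along the radius to any \<open>z\<close> with \<open>z ^ 2 ^ K = 1\<close> all but finitely
  many of its terms are nonnegative and tend to \<open>1\<close>, so the real part tends to infinity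
  (\<open>lacunary_series_at_top\<close>).

  The arguments of these \<open>z\<close> are dense, so every neighbourhood of every point of the
  critical line contains a point at which the zeta function is unbounded on approach from the
  right. A holomorphic extension would be continuous there, a contradiction.\<close>

section \<open>Dimension and nondegeneracy from two-sided tail bounds\<close>

text \<open>Dividing by \<open>t powr (N + r)\<close>, with \<open>N\<close> the dimension of the space, squeezes the quotient between multiples of
  \<open>t powr (D - r)\<close>. Both contents therefore vanish for \<open>r > D\<close> and are positive for
  \<open>r \<le> D\<close>, so the set of exponents with zero content is exactly \<open>{D<..}\<close>.\<close>
lemma powr_tail_bounds_imp_minkowski_dim_inf:
  fixes \<Omega> :: "'a::euclidean_space set" and c C D :: real
  assumes c: "c > 0" and C: "C \<ge> 0"
    and lower: "\<And>t. t \<ge> 1 \<Longrightarrow>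
      ennreal (c * t powr (real DIM('a) + D)) \<le> emeasure lebesgue (tail_at_infinity t \<Omega>)"
    and upper: "\<And>t. t \<ge> 1 \<Longrightarrow>
      emeasure lebesgue (tail_at_infinity t \<Omega>) \<le> ennreal (C * t powr (real DIM('a) + D))"
  shows "has_minkowski_dim_inf \<Omega> (ereal D)" and "minkowski_nondegenerate_inf \<Omega>"
proof -
  let ?q = "\<lambda>r t. emeasure lebesgue (tail_at_infinity t \<Omega>) / ennreal (t powr (real DIM('a) + r))"
  have lower_q: "ennreal (c * t powr (D - r)) \<le> ?q r t" if "t \<ge> 1" for r t
  proof -
    have "ennreal (c * t powr (D - r))
        = ennreal (c * t powr (real DIM('a) + D)) / ennreal (t powr (real DIM('a) + r))"
      using that c by (subst divide_ennreal) (auto simp: powr_diff powr_add)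
    also have "\<dots> \<le> ?q r t"
      using lower[OF that] by (rule divide_right_mono_ennreal)
    finally show ?thesis .
  qed
  have upper_q: "?q r t \<le> ennreal (C * t powr (D - r))" if "t \<ge> 1" for r t
  proof -
    have "?q r t \<le> ennreal (C * t powr (real DIM('a) + D)) / ennreal (t powr (real DIM('a) + r))"
      using upper[OF that] by (rule divide_right_mono_ennreal)
    also have "\<dots> = ennreal (C * t powr (D - r))"
      using that C by (subst divide_ennreal) (auto simp: powr_diff powr_add)
    finally show ?thesis .
  qed
  have le: "lower_minkowski_content_inf r \<Omega> \<le> upper_minkowski_content_inf r \<Omega>" for r
    unfolding lower_minkowski_content_inf_def upper_minkowski_content_inf_def
    by (rule Liminf_le_Limsup) simp
  have zero: "upper_minkowski_content_inf r \<Omega> = 0" if "r > D" for r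
  proof -
    have "((\<lambda>t. C * t powr (D - r)) \<longlongrightarrow> C * 0) at_top"
      using that by (intro tendsto_intros tendsto_neg_powr filterlim_ident) auto
    hence "((\<lambda>t. ennreal (C * t powr (D - r))) \<longlongrightarrow> ennreal 0) at_top"
      by (intro tendsto_ennrealI) simp
    hence "Limsup at_top (\<lambda>t. ennreal (C * t powr (D - r))) = 0"
      by (intro lim_imp_Limsup) auto
    moreover have "upper_minkowski_content_inf r \<Omega> \<le> Limsup at_top (\<lambda>t. ennreal (C * t powr (D - r)))"
      unfolding upper_minkowski_content_inf_def
      by (rule Limsup_mono) (use upper_q in \<open>auto intro: eventually_at_top_linorderI[of 1]\<close>)
    ultimately show ?thesis by simp
  qed
  have pos: "lower_minkowski_content_inf r \<Omega> > 0" if "r \<le> D" for r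
  proof -
    have "ennreal c \<le> ?q r t" if "t \<ge> 1" for t
    proof -
      have "c * 1 \<le> c * t powr (D - r)"
        using that \<open>r \<le> D\<close> c by (intro mult_left_mono ge_one_powr_ge_zero) auto
      thus ?thesis using order_trans[OF ennreal_leI lower_q[OF that, of r]] by simp
    qed
    hence "ennreal c \<le> lower_minkowski_content_inf r \<Omega>"
      unfolding lower_minkowski_content_inf_def
      by (intro Liminf_bounded) (auto intro: eventually_at_top_linorderI[of 1])
    thus ?thesis using c by (meson ennreal_less_zero_iff less_le_trans)
  qed
  have "upper_minkowski_content_inf r \<Omega> = 0 \<longleftrightarrow> r \<in> {D<..}"
    "lower_minkowski_content_inf r \<Omega> = 0 \<longleftrightarrow> r \<in> {D<..}" for r
    using zero[of r] pos[of r] le[of r] by (cases "r > D"; simp)+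
  moreover have "Inf (ereal ` {D<..}) = ereal D"
  proof (rule antisym)
    show "Inf (ereal ` {D<..}) \<le> ereal D"
    proof (rule ereal_le_epsilon2)
      fix e :: real assume "e > 0"
      thus "Inf (ereal ` {D<..}) \<le> ereal D + ereal e" by (intro Inf_lower) auto
    qed
  qed (auto intro: Inf_greatest)
  ultimately show "has_minkowski_dim_inf \<Omega> (ereal D)"
    by (simp flip: greaterThan_def add: has_minkowski_dim_inf_def upper_minkowski_dim_inf_def lower_minkowski_dim_inf_def)
  have "upper_minkowski_content_inf D \<Omega> \<le> ennreal C"
    unfolding upper_minkowski_content_inf_def
  proof (rule Limsup_bounded, rule eventually_at_top_linorderI[of 1])
    fix t :: real assume "1 \<le> t"
    thus "?q D t \<le> ennreal C" using upper_q[of t D] by simp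
  qed
  hence "upper_minkowski_content_inf D \<Omega> < \<infinity>"
    by (simp add: order_le_less_trans)
  thus "minkowski_nondegenerate_inf \<Omega>"
    unfolding minkowski_nondegenerate_inf_def using pos[of D] le[of D] by auto
qed

section \<open>A lacunary series unbounded at dyadic roots of unity\<close>

text \<open>The constant term \<open>1\<close> keeps the weights away from \<open>0\<close>, as nondegeneracy demands; the extra
  \<open>1\<close> at the powers of two creates the natural boundary.\<close>
definition lacunary_weight :: "nat \<Rightarrow> real" where
  "lacunary_weight n = (if \<exists>k. n = 2 ^ k then 2 else 1)"

lemma lacunary_weight_bounds: "1 \<le> lacunary_weight n" "lacunary_weight n \<le> 2"
  by (auto simp: lacunary_weight_def)

lemma summable_lacunary_series:
  fixes w :: complex
  assumes "norm w < 1"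
  shows "summable (\<lambda>n. of_real (lacunary_weight n) * w ^ n)"
proof (rule summable_comparison_test')
  show "summable (\<lambda>n. 2 * norm w ^ n)" using assms by (intro summable_mult summable_geometric) simp
  show "norm (of_real (lacunary_weight n) * w ^ n) \<le> 2 * norm w ^ n" for n
    using lacunary_weight_bounds[of n] by (auto simp: norm_mult norm_power intro!: mult_right_mono)
qed

text \<open>The geometric part \<open>1 / (1 - w)\<close> cannot cancel a divergence to plus infinity, because its
  real part is nonnegative for \<open>norm w < 1\<close>; for \<open>z = 1\<close> it diverges to plus infinity itself.
  In the lacunary part the terms with \<open>k \<ge> K\<close> are the nonnegative reals \<open>x ^ 2 ^ k\<close>, and as many
  of them as desired exceed \<open>1/2\<close> once \<open>x\<close> is close to \<open>1\<close>, while the terms of index below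
  \<open>2 ^ K\<close> contribute at least \<open>- (2 ^ K)\<close>.\<close>
lemma lacunary_series_at_top:
  fixes z :: complex
  assumes z: "z ^ (2 ^ K) = 1"
  shows "filterlim (\<lambda>x. Re (\<Sum>n. of_real (lacunary_weight n) * (z * of_real x) ^ n)) at_top (at_left 1)"
  unfolding filterlim_at_top
proof
  fix B :: real
  have nz: "norm z = 1"
    using z by (metis norm_one norm_power power_eq_1_iff norm_ge_zero abs_of_nonneg zero_neq_numeral power_eq_0_iff real_norm_def)
  \<comment> \<open>\<open>L\<close> dyadic terms, each at least \<open>1/2\<close>, outweigh the loss \<open>2 ^ K\<close> from the initial terms
    and still leave \<open>B\<close>.\<close>
  obtain L :: nat where L: "real L > 2 * (B + 2 ^ K)" using reals_Archimedean2 by blast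
  have "((\<lambda>x::real. x ^ (2 ^ (K + L))) \<longlongrightarrow> 1 ^ (2 ^ (K + L))) (at_left 1)"
    by (intro tendsto_intros)
  hence "eventually (\<lambda>x::real. x ^ (2 ^ (K + L)) > 1/2) (at_left 1)"
    by (rule order_tendstoD) simp
  moreover have "eventually (\<lambda>x::real. x \<in> {0<..<1}) (at_left 1)"
    by (rule eventually_at_left_real) simp
  ultimately show "eventually (\<lambda>x. B \<le> Re (\<Sum>n. of_real (lacunary_weight n) * (z * of_real x) ^ n)) (at_left 1)"
  proof eventually_elim
    fix x :: real assume x: "x ^ (2 ^ (K + L)) > 1/2" "x \<in> {0<..<1}"
    define w where "w = z * of_real x"
    define p :: "nat \<Rightarrow> real" where "p n = lacunary_weight n - 1" for n
    have p01: "0 \<le> p n" "p n \<le> 1" for n by (auto simp: p_def lacunary_weight_def)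
    have nw: "norm w < 1" using x by (simp add: w_def norm_mult nz)
    have sums_w: "(\<lambda>n. w ^ n) sums (1 / (1 - w))" by (rule geometric_sums[OF nw])
    have sum_p: "summable (\<lambda>n. of_real (p n) * w ^ n)"
      using summable_diff[OF summable_lacunary_series[OF nw] sums_summable[OF sums_w]]
      by (simp add: p_def algebra_simps)
    have "(\<Sum>n. of_real (lacunary_weight n) * w ^ n) = (\<Sum>n. w ^ n + of_real (p n) * w ^ n)"
      by (simp add: p_def algebra_simps)
    also have "\<dots> = 1 / (1 - w) + (\<Sum>n. of_real (p n) * w ^ n)"
      using suminf_add[OF sums_summable[OF sums_w] sum_p] sums_unique[OF sums_w] by simp
    finally have split: "Re (\<Sum>n. of_real (lacunary_weight n) * w ^ n)
        = Re (1 / (1 - w)) + (\<Sum>n. Re (of_real (p n) * w ^ n))"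
      by (simp add: Re_suminf[OF sum_p])
    have "Re w < 1" using nw complex_Re_le_cmod[of w] by linarith
    hence geometric_part: "0 \<le> Re (1 / (1 - w))" by (simp add: Re_divide)
    have dyadic: "w ^ (2 ^ k) = of_real (x ^ (2 ^ k))" if "k \<ge> K" for k
    proof -
      have "z ^ (2 ^ k) = (z ^ (2 ^ K)) ^ (2 ^ (k - K))"
        using that by (simp flip: power_mult power_add)
      thus ?thesis by (simp add: w_def z power_mult_distrib)
    qed
    let ?I = "{..<(2::nat) ^ K} \<union> (\<lambda>k. 2 ^ k) ` {K..<K + L}"
    have "real L / 2 - 2 ^ K \<le> (\<Sum>n\<in>?I. Re (of_real (p n) * w ^ n))"
    proof -
      have "(\<Sum>n<(2::nat)^K. - 1 :: real) \<le> (\<Sum>n<(2::nat)^K. Re (of_real (p n) * w ^ n))"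
      proof (rule sum_mono)
        fix n
        have "norm (of_real (p n) * w ^ n) \<le> 1 * 1"
          unfolding norm_mult using p01[of n] nw by (intro mult_mono) (auto simp: norm_power power_le_one)
        thus "- 1 \<le> Re (of_real (p n) * w ^ n)"
          using abs_Re_le_cmod[of "of_real (p n) * w ^ n"] by linarith
      qed
      moreover have "(\<Sum>k\<in>{K..<K+L}. 1/2 :: real) \<le> (\<Sum>k\<in>{K..<K+L}. Re (of_real (p (2^k)) * w ^ (2^k)))"
      proof (rule sum_mono)
        fix k assume k: "k \<in> {K..<K+L}"
        have "1/2 < x ^ (2 ^ k)"
          by (rule less_le_trans[OF x(1)], intro power_decreasing power_increasing) (use x k in auto)
        moreover have "p (2 ^ k) = 1" by (auto simp: p_def lacunary_weight_def)
        ultimately show "1/2 \<le> Re (of_real (p (2^k)) * w ^ (2^k))"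
          using k by (simp add: dyadic del: of_real_power)
      qed
      moreover have "(\<Sum>n\<in>?I. Re (of_real (p n) * w ^ n))
          = (\<Sum>n<(2::nat)^K. Re (of_real (p n) * w ^ n)) + (\<Sum>k\<in>{K..<K+L}. Re (of_real (p (2^k)) * w ^ (2^k)))"
        by (subst sum.union_disjoint) (auto simp: sum.reindex inj_on_def)
      ultimately show ?thesis by simp
    qed
    also have "\<dots> \<le> (\<Sum>n. Re (of_real (p n) * w ^ n))"
    proof (rule sum_le_suminf)
      show "summable (\<lambda>n. Re (of_real (p n) * w ^ n))" using sum_p by (rule summable_Re)
      fix n assume n: "n \<in> - ?I"
      show "0 \<le> Re (of_real (p n) * w ^ n)"
      proof (cases "\<exists>k. n = 2 ^ k")
        case True
        then obtain k where k: "n = 2 ^ k" by blast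
        with n have "k \<ge> K" by auto
        thus ?thesis using x p01 by (simp add: k dyadic del: of_real_power)
      qed (simp add: p_def lacunary_weight_def)
    qed simp
    finally show "B \<le> Re (\<Sum>n. of_real (lacunary_weight n) * (z * of_real x) ^ n)"
      using split geometric_part L by (simp add: w_def)
  qed
qed

section \<open>Powers of comparable radii\<close>

text \<open>The exponent may have either sign, so the constant involves its absolute value.\<close>
lemma powr_le_of_comparable:
  fixes a u p :: real
  assumes "0 < a" "a \<le> u" "u \<le> 2 * a"
  shows "u powr p \<le> 2 powr \<bar>p\<bar> * a powr p"
proof -
  have "u powr p = (u / a) powr p * a powr p"
    using assms by (simp add: powr_divide)
  also have "(u / a) powr p \<le> (u / a) powr \<bar>p\<bar>"
    using assms by (intro powr_mono) auto
  also have "\<dots> \<le> 2 powr \<bar>p\<bar>"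
    using assms by (intro powr_mono2) (auto simp: field_simps)
  finally show ?thesis by (simp add: mult_right_mono)
qed

text \<open>The mean value inequality on the real segment, where
  the derivative \<open>p * z powr (p - 1)\<close> is controlled by its size at the left end.\<close>
lemma norm_diff_powr_le_of_comparable:
  fixes a u :: real and p :: complex
  assumes "0 < a" "a \<le> u" "u \<le> 2 * a"
  shows "norm (of_real u powr p - of_real a powr p)
    \<le> norm p * 2 powr \<bar>Re p - 1\<bar> * a powr (Re p - 1) * (u - a)"
proof -
  let ?S = "of_real ` {a..2 * a} :: complex set"
  have "norm (of_real u powr p - of_real a powr p :: complex)
      \<le> norm p * (2 powr \<bar>Re p - 1\<bar> * a powr (Re p - 1)) * norm (of_real u - of_real a :: complex)"
  proof (rule field_differentiable_bound[where S = ?S and f' = "\<lambda>z. p * z powr (p - 1)"])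
    show "convex ?S" by (intro convex_linear_image linear_of_real) auto
    fix z assume "z \<in> ?S"
    then obtain v where v: "z = of_real v" "a \<le> v" "v \<le> 2 * a" by auto
    show "((\<lambda>z. z powr p) has_field_derivative p * z powr (p - 1)) (at z within ?S)"
      using v assms
      by (intro has_field_derivative_at_within[OF has_field_derivative_powr])
        (simp add: complex_nonpos_Reals_iff)
    have "norm (z powr (p - 1)) = v powr (Re p - 1)"
      using v assms by (subst norm_powr_real_powr) auto
    also have "\<dots> \<le> 2 powr \<bar>Re p - 1\<bar> * a powr (Re p - 1)"
      using v assms by (intro powr_le_of_comparable) auto
    finally show "norm (p * z powr (p - 1)) \<le> norm p * (2 powr \<bar>Re p - 1\<bar> * a powr (Re p - 1))"
      by (simp add: norm_mult mult_left_mono)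
  qed (use assms in auto)
  also have "norm (of_real u - of_real a :: complex) = u - a"
    using assms by (simp flip: of_real_diff)
  finally show ?thesis by (simp add: mult.assoc)
qed

section \<open>The shells\<close>

definition shell_area :: "real \<Rightarrow> nat \<Rightarrow> real" where
  "shell_area D n = lacunary_weight n * exp ((2 + D) * real n)"

text \<open>Chosen so that the shell has area exactly \<open>shell_area D n\<close>. An exact area turns the leading
  part of the zeta function into an exact power series.\<close>
definition outer_radius :: "real \<Rightarrow> nat \<Rightarrow> real" where
  "outer_radius D n = sqrt (exp (real n) ^ 2 + shell_area D n / pi)"

definition shell :: "real \<Rightarrow> nat \<Rightarrow> (real ^ 2) set" where
  "shell D n = {x. exp (real n) \<le> norm x \<and> norm x < outer_radius D n}"

lemma shell_area_bounds:
  "exp ((2 + D) * real n) \<le> shell_area D n" "shell_area D n \<le> 2 * exp ((2 + D) * real n)"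
  using lacunary_weight_bounds[of n] by (simp_all add: shell_area_def)

lemma shell_area_nonneg: "0 \<le> shell_area D n"
  using shell_area_bounds(1)[of D n] by (meson exp_ge_zero order_trans)

text \<open>The last estimate says how thin the shell is: the difference of the squared radii is at
  most the area, and the sum of the radii is at least the inner radius. The comparability with factor \<open>2\<close>
  also separates consecutive shells, since \<open>2 < exp 1\<close>.\<close>
lemma outer_radius_bounds:
  assumes "D < -2"
  shows "exp (real n) \<le> outer_radius D n"
    and "outer_radius D n \<le> 2 * exp (real n)"
    and "outer_radius D n - exp (real n) \<le> shell_area D n / exp (real n)"
proof -
  let ?a = "exp (real n)"
  have a: "?a \<ge> 1" by simp
  have sq: "outer_radius D n ^ 2 = ?a ^ 2 + shell_area D n / pi"
    unfolding outer_radius_def using shell_area_nonneg[of D n] by (intro real_sqrt_pow2) simp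
  have nonneg: "outer_radius D n \<ge> 0"
    unfolding outer_radius_def using shell_area_nonneg[of D n] by simp
  show ge: "?a \<le> outer_radius D n"
  proof (rule power2_le_imp_le[OF _ nonneg])
    show "?a ^ 2 \<le> outer_radius D n ^ 2"
      unfolding sq using shell_area_nonneg[of D n] by simp
  qed
  have "(2 + D) * real n \<le> 0" using assms by (intro mult_nonpos_nonneg) auto
  hence "exp ((2 + D) * real n) \<le> 1" by simp
  hence "shell_area D n \<le> 2" using shell_area_bounds(2)[of D n] by linarith
  hence "shell_area D n / pi \<le> 1" using pi_gt3 by simp
  also have "1 \<le> ?a ^ 2" using a by (simp add: one_le_power)
  finally have "outer_radius D n ^ 2 \<le> ?a ^ 2 + ?a ^ 2" using sq by linarith
  also have "\<dots> \<le> (2 * ?a) ^ 2" by (simp add: power_mult_distrib)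
  finally have "outer_radius D n ^ 2 \<le> (2 * ?a) ^ 2" .
  thus "outer_radius D n \<le> 2 * ?a" by (rule power2_le_imp_le) simp
  have "(outer_radius D n - ?a) * ?a \<le> (outer_radius D n - ?a) * (outer_radius D n + ?a)"
    using ge nonneg by (intro mult_left_mono) auto
  also have "\<dots> = shell_area D n / pi" using sq by (simp add: power2_eq_square algebra_simps)
  also have "\<dots> \<le> shell_area D n" using shell_area_nonneg[of D n] pi_gt3 by (simp add: divide_le_eq mult_le_cancel_left1)
  finally show "outer_radius D n - ?a \<le> shell_area D n / ?a" by (simp add: field_simps)
qed

lemma norm_mem_shell:
  assumes "D < -2" "x \<in> shell D n"
  shows "exp (real n) \<le> norm x" "norm x < 2 * exp (real n)"
    "norm x - exp (real n) \<le> shell_area D n / exp (real n)"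
  using assms outer_radius_bounds[of D n] by (auto simp: shell_def)

lemma shell_eq_Diff: "shell D n = ball 0 (outer_radius D n) - ball 0 (exp (real n))"
  by (auto simp: shell_def)

lemma shell_borel: "shell D n \<in> sets borel"
  unfolding shell_eq_Diff by simp

lemma shell_sets: "shell D n \<in> sets lebesgue"
  using shell_borel by simp

lemma emeasure_shell:
  assumes "D < -2"
  shows "emeasure lebesgue (shell D n) = ennreal (shell_area D n)"
proof -
  let ?b = "outer_radius D n" and ?a = "exp (real n)"
  have b: "?a \<le> ?b" "0 \<le> ?b" using outer_radius_bounds(1)[OF assms, of n] by (auto intro: order_trans[OF exp_ge_zero])
  have ball: "emeasure lborel (ball 0 r :: (real ^ 2) set) = ennreal (pi * r ^ 2)" if "r \<ge> 0" for r
    using emeasure_ball[OF that, of "0 :: real ^ 2"] by (simp add: unit_ball_vol_2)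
  have "emeasure lebesgue (shell D n) = emeasure lborel (shell D n)"
    using shell_borel[of D n] by simp
  also have "\<dots> = emeasure lborel (ball 0 ?b :: (real ^ 2) set) - emeasure lborel (ball 0 ?a :: (real ^ 2) set)"
    unfolding shell_eq_Diff using b by (intro emeasure_Diff) (auto simp: ball)
  also have "\<dots> = ennreal (pi * ?b ^ 2 - pi * ?a ^ 2)"
    using b by (simp add: ball ennreal_minus)
  also have "pi * ?b ^ 2 - pi * ?a ^ 2 = shell_area D n"
    unfolding outer_radius_def using shell_area_nonneg[of D n]
    by (simp add: algebra_simps)
  finally show ?thesis .
qed

lemma shell_disjoint:
  assumes "D < -2" "m \<noteq> n"
  shows "shell D m \<inter> shell D n = {}"
proof -
  have "shell D m \<inter> shell D n = {}" if "m < n" for m n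
  proof -
    have "2 * exp (real m) \<le> exp 1 * exp (real m)"
      using exp_ge_add_one_self[of 1] by (intro mult_right_mono) auto
    also have "\<dots> = exp (real (m + 1))" by (simp add: exp_add)
    also have "\<dots> \<le> exp (real n)" using that by simp
    finally show ?thesis using outer_radius_bounds(2)[OF assms(1), of m] by (auto simp: shell_def)
  qed
  thus ?thesis using assms(2) by (metis Int_commute nat_neq_iff)
qed

section \<open>The union of the shells and its tails\<close>

definition shell_union :: "real \<Rightarrow> (real ^ 2) set" where
  "shell_union D = (\<Union>n. shell D n)"

lemma tail_shell_union_subset:
  assumes "D < -2" "exp (real m) \<le> t"
  shows "tail_at_infinity t (shell_union D) \<subseteq> (\<Union>k. shell D (k + m))"
proof
  fix x assume "x \<in> tail_at_infinity t (shell_union D)"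
  then obtain n where n: "x \<in> shell D n" "t \<le> norm x"
    by (auto simp: tail_at_infinity_def shell_union_def)
  have "exp (real m) < 2 * exp (real n)"
    using norm_mem_shell(2)[OF assms(1) n(1)] n(2) assms(2) by linarith
  also have "\<dots> \<le> exp 1 * exp (real n)"
    using exp_ge_add_one_self[of 1] by (intro mult_right_mono) auto
  also have "\<dots> = exp (real (n + 1))" by (simp add: exp_add)
  finally have "m \<le> n" by simp
  with n(1) show "x \<in> (\<Union>k. shell D (k + m))"
    by (intro UN_I[of "n - m"]) auto
qed

text \<open>From below, the first shell lying entirely outside the disc suffices; its index is
  \<open>\<lceil>ln t\<rceil>\<close>. From above, the shells meeting the tail have index at least \<open>\<lfloor>ln t\<rfloor>\<close>, and their
  areas are dominated by a geometric series of ratio \<open>exp (2 + D) < 1\<close>. The factors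
  \<open>exp (2 + D)\<close> and \<open>exp (- (2 + D))\<close> pay for the rounding of \<open>ln t\<close>.\<close>
lemma tail_shell_union_emeasure_bounds:
  assumes D: "D < -2" and t: "t \<ge> 1"
  shows "ennreal (exp (2 + D) * t powr (2 + D)) \<le> emeasure lebesgue (tail_at_infinity t (shell_union D))"
    and "emeasure lebesgue (tail_at_infinity t (shell_union D))
      \<le> ennreal (2 * exp (- (2 + D)) / (1 - exp (2 + D)) * t powr (2 + D))"
proof -
  have powr_exp: "t powr (2 + D) = exp ((2 + D) * ln t)" using t by (simp add: powr_def)
  define m where "m = nat \<lceil>ln t\<rceil>"
  have m: "ln t \<le> real m" "real m \<le> ln t + 1" using t unfolding m_def by (auto simp: of_nat_ceiling)
  hence "t \<le> exp (real m)" using t by (metis exp_le_cancel_iff exp_ln less_le_trans zero_less_one)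
  hence "shell D m \<subseteq> tail_at_infinity t (shell_union D)"
    by (force simp: tail_at_infinity_def shell_union_def shell_def)
  moreover have tail_sets: "tail_at_infinity t (shell_union D) \<in> sets lebesgue"
    unfolding tail_at_infinity_def shell_union_def using shell_sets by (intro sets.Int sets.countable_UN) auto
  ultimately have "ennreal (shell_area D m) \<le> emeasure lebesgue (tail_at_infinity t (shell_union D))"
    unfolding emeasure_shell[OF D, symmetric] by (rule emeasure_mono)
  moreover have "exp (2 + D) * t powr (2 + D) \<le> shell_area D m"
  proof -
    have "(2 + D) * (ln t + 1) \<le> (2 + D) * real m" using D m by (intro mult_left_mono_neg) auto
    hence "exp ((2 + D) * (ln t + 1)) \<le> exp ((2 + D) * real m)" by simp
    also have "\<dots> \<le> shell_area D m" by (rule shell_area_bounds)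
    also have "exp ((2 + D) * (ln t + 1)) = exp (2 + D) * t powr (2 + D)"
      unfolding powr_exp exp_add[symmetric] by (simp add: algebra_simps)
    finally show ?thesis .
  qed
  ultimately show "ennreal (exp (2 + D) * t powr (2 + D)) \<le> emeasure lebesgue (tail_at_infinity t (shell_union D))"
    by (meson ennreal_leI order_trans)

  define l where "l = nat \<lfloor>ln t\<rfloor>"
  have l: "real l \<le> ln t" "ln t \<le> real l + 1" using t unfolding l_def by (auto simp: of_nat_floor)
  hence "exp (real l) \<le> t" using t by (metis exp_le_cancel_iff exp_ln less_le_trans zero_less_one)
  hence "emeasure lebesgue (tail_at_infinity t (shell_union D)) \<le> emeasure lebesgue (\<Union>k. shell D (k + l))"
    using D shell_sets by (intro emeasure_mono tail_shell_union_subset sets.countable_UN) auto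
  also have "\<dots> \<le> (\<Sum>k. emeasure lebesgue (shell D (k + l)))"
    using shell_sets by (intro emeasure_subadditive_countably) auto
  also have "\<dots> \<le> (\<Sum>k. ennreal (2 * exp ((2 + D) * real l) * exp (2 + D) ^ k))"
  proof (rule suminf_le)
    fix k
    have "shell_area D (k + l) \<le> 2 * exp ((2 + D) * real (k + l))" by (rule shell_area_bounds)
    also have "\<dots> = 2 * exp ((2 + D) * real l) * exp (2 + D) ^ k"
      by (simp add: exp_of_nat_mult[symmetric] exp_add[symmetric] algebra_simps)
    finally show "emeasure lebesgue (shell D (k + l)) \<le> ennreal (2 * exp ((2 + D) * real l) * exp (2 + D) ^ k)"
      by (simp add: emeasure_shell[OF D] ennreal_leI)
  qed auto
  also have "\<dots> = ennreal (2 * exp ((2 + D) * real l) * (1 / (1 - exp (2 + D))))"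
    using D by (intro suminf_ennreal_eq sums_mult geometric_sums) auto
  also have "\<dots> \<le> ennreal (2 * exp (- (2 + D)) / (1 - exp (2 + D)) * t powr (2 + D))"
  proof (rule ennreal_leI)
    have "(2 + D) * real l \<le> (2 + D) * (ln t - 1)" using D l by (intro mult_left_mono_neg) auto
    hence "exp ((2 + D) * real l) \<le> exp (- (2 + D)) * t powr (2 + D)"
      unfolding powr_exp exp_add[symmetric] by (simp add: algebra_simps)
    thus "2 * exp ((2 + D) * real l) * (1 / (1 - exp (2 + D)))
        \<le> 2 * exp (- (2 + D)) / (1 - exp (2 + D)) * t powr (2 + D)"
      using D by (simp add: divide_right_mono)
  qed
  finally show "emeasure lebesgue (tail_at_infinity t (shell_union D))
      \<le> ennreal (2 * exp (- (2 + D)) / (1 - exp (2 + D)) * t powr (2 + D))" .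
qed

section \<open>The zeta function of the union of the shells\<close>

text \<open>The cutoff \<open>T\<close> truncates or removes only finitely many shells; with it built in, these
  integrals sum to the zeta function for every \<open>T\<close>.\<close>
definition shell_zeta_integrand :: "real \<Rightarrow> real \<Rightarrow> complex \<Rightarrow> nat \<Rightarrow> real ^ 2 \<Rightarrow> complex" where
  "shell_zeta_integrand D T s n x =
     indicator (shell D n - ball 0 T) x *\<^sub>R (of_real (norm x) powr (- s - 2))"

lemma shell_area_times_inner_radius_powr:
  "shell_area D n * exp (real n) powr (- \<sigma> - 2) = lacunary_weight n * exp (D - \<sigma>) ^ n"
  by (simp add: shell_area_def powr_def exp_of_nat_mult[symmetric] exp_add[symmetric] algebra_simps)

lemma shell_zeta_leading_term:
  fixes s :: complex
  shows "of_real (shell_area D n) * of_real (exp (real n)) powr (- s - 2)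
    = of_real (lacunary_weight n) * exp (of_real D - s) ^ n"
proof -
  have "complex_of_real (exp (real n)) powr (- s - 2) = exp ((- s - 2) * of_nat n)"
    by (simp add: powr_def Ln_of_real flip: of_real_exp)
  moreover have "complex_of_real (exp ((2 + D) * real n)) = exp ((2 + of_real D) * of_nat n)"
    by (subst exp_of_real[symmetric]) simp
  ultimately show ?thesis
    by (simp add: shell_area_def exp_of_nat_mult[symmetric] exp_add[symmetric] algebra_simps)
qed

text \<open>A crude majorant, constant on the shell; it yields integrability and absolute
  convergence of the sum over the shells to the right of the critical line.\<close>
lemma norm_shell_zeta_integrand_le:
  assumes "D < -2"
  shows "norm (shell_zeta_integrand D T s n x)
    \<le> indicator (shell D n) x * (2 powr \<bar>Re s + 2\<bar> * exp (real n) powr (- Re s - 2))"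
proof (cases "x \<in> shell D n - ball 0 T")
  case True
  have "norm x powr (- Re s - 2) \<le> 2 powr \<bar>- Re s - 2\<bar> * exp (real n) powr (- Re s - 2)"
    using norm_mem_shell(1,2)[OF assms, of x n] True by (intro powr_le_of_comparable) auto
  moreover have "\<bar>- Re s - 2\<bar> = \<bar>Re s + 2\<bar>" by simp
  ultimately show ?thesis
    using True by (simp add: shell_zeta_integrand_def norm_powr_real_powr)
qed (simp add: shell_zeta_integrand_def)

lemma integrable_indicator_shell:
  assumes "D < -2"
  shows "integrable lebesgue (\<lambda>x. indicator (shell D n) x * (c :: real))"
    and "(\<integral>x. indicator (shell D n) x * (c :: real) \<partial>lebesgue) = shell_area D n * c"
proof -
  have "measure lebesgue (shell D n) = shell_area D n"
    unfolding Sigma_Algebra.measure_def emeasure_shell[OF assms] using shell_area_nonneg[of D n] by simp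
  moreover have "integrable lebesgue (indicator (shell D n) :: _ \<Rightarrow> real)"
    by (rule integrable_real_indicator[OF shell_sets]) (simp add: emeasure_shell[OF assms] del: emeasure_completion)
  ultimately show "integrable lebesgue (\<lambda>x. indicator (shell D n) x * (c :: real))"
    and "(\<integral>x. indicator (shell D n) x * (c :: real) \<partial>lebesgue) = shell_area D n * c"
    by simp_all
qed

lemma shell_zeta_integrand_measurable: "shell_zeta_integrand D T s n \<in> borel_measurable lebesgue"
proof -
  have "(\<lambda>x :: real ^ 2. complex_of_real (norm x)) \<in> borel_measurable borel"
    by (intro borel_measurable_continuous_onI continuous_intros)
  from measurable_compose[OF this Ln_measurable]
  have "(\<lambda>x :: real ^ 2. complex_of_real (norm x) powr (- s - 2)) \<in> borel_measurable borel"
    unfolding powr_def by (intro measurable_If) simp_all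
  hence "shell_zeta_integrand D T s n \<in> borel_measurable borel"
    unfolding shell_zeta_integrand_def
    by (intro borel_measurable_scaleR borel_measurable_indicator sets.Diff shell_borel) simp_all
  thus ?thesis by (simp add: measurable_completion)
qed

lemma shell_zeta_integrand_integrable:
  assumes "D < -2"
  shows "integrable lebesgue (shell_zeta_integrand D T s n)"
    and "(\<integral>x. norm (shell_zeta_integrand D T s n x) \<partial>lebesgue)
      \<le> 2 powr \<bar>Re s + 2\<bar> * (lacunary_weight n * exp (D - Re s) ^ n)"
proof -
  let ?C = "2 powr \<bar>Re s + 2\<bar> * exp (real n) powr (- Re s - 2)"
  show int: "integrable lebesgue (shell_zeta_integrand D T s n)"
  proof (rule Bochner_Integration.integrable_bound)
    show "integrable lebesgue (\<lambda>x. indicator (shell D n) x * ?C)"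
      by (rule integrable_indicator_shell[OF assms])
    show "AE x in lebesgue. norm (shell_zeta_integrand D T s n x) \<le> norm (indicator (shell D n) x * ?C)"
      using norm_shell_zeta_integrand_le[OF assms, of T s n] by (intro AE_I2) (auto intro: order_trans)
  qed (rule shell_zeta_integrand_measurable)
  have "(\<integral>x. norm (shell_zeta_integrand D T s n x) \<partial>lebesgue) \<le> (\<integral>x. indicator (shell D n) x * ?C \<partial>lebesgue)"
    using int norm_shell_zeta_integrand_le[OF assms]
    by (intro integral_mono integrable_norm integrable_indicator_shell[OF assms])
  also have "\<dots> = 2 powr \<bar>Re s + 2\<bar> * (shell_area D n * exp (real n) powr (- Re s - 2))"
    unfolding integrable_indicator_shell(2)[OF assms] by (rule mult.left_commute)
  finally show "(\<integral>x. norm (shell_zeta_integrand D T s n x) \<partial>lebesgue)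
      \<le> 2 powr \<bar>Re s + 2\<bar> * (lacunary_weight n * exp (D - Re s) ^ n)"
    unfolding shell_area_times_inner_radius_powr .
qed

text \<open>For the finitely many shells affected by the cutoff, both the integral and the leading term
  are estimated separately.\<close>
lemma shell_zeta_error_crude:
  assumes "D < -2" "D \<le> Re s"
  shows "norm ((\<integral>x. shell_zeta_integrand D T s n x \<partial>lebesgue)
      - of_real (lacunary_weight n) * exp (of_real D - s) ^ n) \<le> 2 * (2 powr \<bar>Re s + 2\<bar> + 1)"
proof -
  have "lacunary_weight n * exp (D - Re s) ^ n \<le> 2 * 1"
    using assms lacunary_weight_bounds[of n] by (intro mult_mono power_le_one) auto
  hence le2: "lacunary_weight n * exp (D - Re s) ^ n \<le> 2" by simp
  have "norm (\<integral>x. shell_zeta_integrand D T s n x \<partial>lebesgue)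
      \<le> (\<integral>x. norm (shell_zeta_integrand D T s n x) \<partial>lebesgue)"
    by (rule integral_norm_bound)
  also have "\<dots> \<le> 2 powr \<bar>Re s + 2\<bar> * (lacunary_weight n * exp (D - Re s) ^ n)"
    by (rule shell_zeta_integrand_integrable[OF assms(1)])
  also have "\<dots> \<le> 2 powr \<bar>Re s + 2\<bar> * 2"
    using le2 by (intro mult_left_mono) auto
  finally have "norm (\<integral>x. shell_zeta_integrand D T s n x \<partial>lebesgue) \<le> 2 powr \<bar>Re s + 2\<bar> * 2" .
  moreover have "norm (of_real (lacunary_weight n) * exp (of_real D - s) ^ n) \<le> 2"
    using le2 lacunary_weight_bounds[of n] by (simp add: norm_mult norm_power norm_exp_eq_Re)
  ultimately show ?thesis by (intro norm_triangle_le_diff) simp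
qed

text \<open>On a shell untouched by the cutoff the integrand varies by at most its derivative times the
  thickness. Since the thickness is itself of order area over inner radius, the error carries a
  second factor of the area: it is of order \<open>exp (n (2 D - Re s))\<close>, which for \<open>Re s \<ge> D\<close>
  is at most \<open>exp (D n)\<close> and hence summable uniformly up to the critical line.\<close>
lemma shell_zeta_error_fine:
  assumes D: "D < -2" and s: "D \<le> Re s" and T: "T \<le> exp (real n)"
  shows "norm ((\<integral>x. shell_zeta_integrand D T s n x \<partial>lebesgue)
      - of_real (lacunary_weight n) * exp (of_real D - s) ^ n)
    \<le> 4 * norm (s + 2) * 2 powr \<bar>Re s + 3\<bar> * exp D ^ n"
proof -
  let ?a = "exp (real n)"
  let ?p = "- s - 2"
  let ?c = "indicator (shell D n) :: real ^ 2 \<Rightarrow> real"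
  define \<kappa> where "\<kappa> = norm (s + 2) * 2 powr \<bar>Re s + 3\<bar> * ?a powr (- Re s - 3) * (shell_area D n / ?a)"
  have int_const: "integrable lebesgue (\<lambda>x. ?c x *\<^sub>R (of_real ?a powr ?p :: complex))"
    "(\<integral>x. ?c x *\<^sub>R (of_real ?a powr ?p :: complex) \<partial>lebesgue) = of_real (shell_area D n) * of_real ?a powr ?p"
    using integrable_indicator_shell[OF D, of n 1]
    by (simp_all add: integrable_scaleR_left integral_scaleR_left scaleR_conv_of_real)
  have pointwise: "norm (shell_zeta_integrand D T s n x - ?c x *\<^sub>R (of_real ?a powr ?p :: complex)) \<le> ?c x * \<kappa>" for x
  proof (cases "x \<in> shell D n")
    case True
    note r = norm_mem_shell[OF D True]
    have "norm (of_real (norm x) powr ?p - of_real ?a powr ?p :: complex)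
        \<le> norm ?p * 2 powr \<bar>Re ?p - 1\<bar> * ?a powr (Re ?p - 1) * (norm x - ?a)"
      using r by (intro norm_diff_powr_le_of_comparable) auto
    also have "\<dots> \<le> norm ?p * 2 powr \<bar>Re ?p - 1\<bar> * ?a powr (Re ?p - 1) * (shell_area D n / ?a)"
      using r by (intro mult_left_mono) auto
    also have "norm ?p = norm (s + 2)" using norm_minus_cancel[of "s + 2"] by (simp add: algebra_simps)
    also have "\<bar>Re ?p - 1\<bar> = \<bar>Re s + 3\<bar>" by simp
    also have "Re ?p - 1 = - Re s - 3" by simp
    finally have "norm (of_real (norm x) powr ?p - of_real ?a powr ?p :: complex) \<le> \<kappa>"
      unfolding \<kappa>_def .
    moreover have "x \<notin> ball 0 T" using r(1) T by simp
    ultimately show ?thesis using True by (simp add: shell_zeta_integrand_def)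
  qed (simp add: shell_zeta_integrand_def)
  have "norm ((\<integral>x. shell_zeta_integrand D T s n x \<partial>lebesgue) - of_real (shell_area D n) * of_real ?a powr ?p)
      = norm (\<integral>x. shell_zeta_integrand D T s n x - ?c x *\<^sub>R (of_real ?a powr ?p) \<partial>lebesgue)"
    unfolding int_const(2)[symmetric]
    by (subst Bochner_Integration.integral_diff) (use int_const(1) shell_zeta_integrand_integrable(1)[OF D] in auto)
  also have "\<dots> \<le> (\<integral>x. ?c x * \<kappa> \<partial>lebesgue)"
    by (intro Bochner_Integration.integral_norm_bound_integral Bochner_Integration.integrable_diff pointwise
      int_const(1) shell_zeta_integrand_integrable(1)[OF D] integrable_indicator_shell(1)[OF D])
  also have "\<dots> = shell_area D n * \<kappa>" by (rule integrable_indicator_shell(2)[OF D])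
  also have "\<dots> = norm (s + 2) * 2 powr \<bar>Re s + 3\<bar> * ((shell_area D n * ?a powr (- Re s - 2)) * (shell_area D n * exp (- 2 * real n)))"
  proof -
    have "?a powr (- Re s - 3) / ?a = ?a powr (- Re s - 2) * exp (- 2 * real n)"
      unfolding powr_def by (simp add: exp_add[symmetric] exp_diff[symmetric] algebra_simps)
    thus ?thesis unfolding \<kappa>_def by (simp add: field_simps)
  qed
  also have "\<dots> \<le> norm (s + 2) * 2 powr \<bar>Re s + 3\<bar> * (2 * (2 * exp D ^ n))"
  proof (rule mult_left_mono, rule mult_mono)
    have "lacunary_weight n * exp (D - Re s) ^ n \<le> 2 * 1"
      using s lacunary_weight_bounds[of n] by (intro mult_mono power_le_one) auto
    thus "shell_area D n * ?a powr (- Re s - 2) \<le> 2" unfolding shell_area_times_inner_radius_powr by simp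
    have "shell_area D n * exp (- 2 * real n) \<le> 2 * exp ((2 + D) * real n) * exp (- 2 * real n)"
      by (intro mult_right_mono shell_area_bounds) simp
    also have "\<dots> = 2 * exp D ^ n"
      by (simp add: exp_of_nat_mult[symmetric] exp_add[symmetric] algebra_simps)
    finally show "shell_area D n * exp (- 2 * real n) \<le> 2 * exp D ^ n" .
  qed (use shell_area_nonneg[of D n] in auto)
  finally show ?thesis unfolding shell_zeta_leading_term by (simp add: mult_ac)
qed

lemma distance_zeta_shell_union_sums:
  assumes D: "D < -2" and s: "D < Re s"
  shows "(\<lambda>n. \<integral>x. shell_zeta_integrand D T s n x \<partial>lebesgue) sums distance_zeta_inf T (shell_union D) s"
proof -
  have vanish: "shell_zeta_integrand D T s n x = 0" if "x \<in> shell D k" "n \<noteq> k" for n k x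
  proof -
    have "x \<notin> shell D n" using shell_disjoint[OF D that(2)] that(1) by blast
    thus ?thesis by (simp add: shell_zeta_integrand_def)
  qed
  have pointwise: "(\<lambda>n. shell_zeta_integrand D T s n x) sums
      (indicator (tail_at_infinity T (shell_union D)) x *\<^sub>R (of_real (norm x) powr (- s - 2)))" for x
  proof (cases "x \<in> shell_union D")
    case True
    then obtain k where k: "x \<in> shell D k" by (auto simp: shell_union_def)
    have "(\<lambda>n. shell_zeta_integrand D T s n x) sums (\<Sum>n\<in>{k}. shell_zeta_integrand D T s n x)"
      by (rule sums_finite) (use vanish[OF k] in auto)
    thus ?thesis using k True
      by (auto simp: shell_zeta_integrand_def tail_at_infinity_def indicator_def)
  next
    case False
    thus ?thesis by (auto simp: shell_zeta_integrand_def tail_at_infinity_def shell_union_def)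
  qed
  have "(\<lambda>n. \<integral>x. shell_zeta_integrand D T s n x \<partial>lebesgue) sums
      (\<integral>x. (\<Sum>n. shell_zeta_integrand D T s n x) \<partial>lebesgue)"
  proof (rule sums_integral)
    show "integrable lebesgue (shell_zeta_integrand D T s n)" for n
      by (rule shell_zeta_integrand_integrable[OF D])
    show "AE x in lebesgue. summable (\<lambda>n. norm (shell_zeta_integrand D T s n x))"
    proof (rule AE_I2)
      fix x
      show "summable (\<lambda>n. norm (shell_zeta_integrand D T s n x))"
      proof (cases "x \<in> shell_union D")
        case True
        then obtain k where "x \<in> shell D k" by (auto simp: shell_union_def)
        from vanish[OF this] show ?thesis by (intro summable_finite[of "{k}"]) auto
      qed (simp add: shell_zeta_integrand_def shell_union_def)
    qed
    show "summable (\<lambda>n. \<integral>x. norm (shell_zeta_integrand D T s n x) \<partial>lebesgue)"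
    proof (rule summable_comparison_test')
      show "summable (\<lambda>n. 2 powr \<bar>Re s + 2\<bar> * (2 * exp (D - Re s) ^ n))"
        using s by (intro summable_mult summable_geometric) simp
      fix n
      have "(\<integral>x. norm (shell_zeta_integrand D T s n x) \<partial>lebesgue)
          \<le> 2 powr \<bar>Re s + 2\<bar> * (lacunary_weight n * exp (D - Re s) ^ n)"
        by (rule shell_zeta_integrand_integrable[OF D])
      also have "\<dots> \<le> 2 powr \<bar>Re s + 2\<bar> * (2 * exp (D - Re s) ^ n)"
        using lacunary_weight_bounds[of n] by (intro mult_left_mono mult_right_mono) auto
      finally show "norm (\<integral>x. norm (shell_zeta_integrand D T s n x) \<partial>lebesgue)
          \<le> 2 powr \<bar>Re s + 2\<bar> * (2 * exp (D - Re s) ^ n)"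
        unfolding real_norm_def by (subst abs_of_nonneg) (rule Bochner_Integration.integral_nonneg, rule norm_ge_zero)
    qed
  qed
  also have "(\<lambda>x. \<Sum>n. shell_zeta_integrand D T s n x)
      = (\<lambda>x. indicator (tail_at_infinity T (shell_union D)) x *\<^sub>R (of_real (norm x) powr (- s - 2)))"
    using pointwise by (auto simp: sums_iff)
  finally show ?thesis by (simp add: distance_zeta_inf_def set_lebesgue_integral_def)
qed

text \<open>The bound is uniform on a horizontal segment ending at the critical line, which is the only
  kind of approach used below. The length \<open>1\<close> of the segment only serves to bound
  \<open>norm (s + 2)\<close> and the exponents.\<close>
lemma distance_zeta_shell_union_lacunary:
  assumes D: "D < -2"
  obtains M where "\<And>s. D < Re s \<Longrightarrow> Re s \<le> D + 1 \<Longrightarrow> Im s = \<tau> \<Longrightarrow>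
    norm (distance_zeta_inf T (shell_union D) s
      - (\<Sum>n. of_real (lacunary_weight n) * exp (of_real D - s) ^ n)) \<le> M"
proof -
  define P where "P = (2 :: real) powr (\<bar>D\<bar> + 4)"
  define d where "d n = 4 * (\<bar>D\<bar> + \<bar>\<tau>\<bar> + 3) * P * exp D ^ n
    + (if n \<in> {n. exp (real n) < T} then 2 * (P + 1) else 0)" for n
  have "{n. exp (real n) < T} \<subseteq> {..nat \<lceil>T\<rceil>}"
  proof safe
    fix n assume "exp (real n) < T"
    hence "real n \<le> T" using exp_ge_add_one_self[of "real n"] by linarith
    thus "n \<le> nat \<lceil>T\<rceil>" by linarith
  qed
  hence "finite {n. exp (real n) < T}" by (rule finite_subset) simp
  hence "summable d"
    unfolding d_def using D by (intro summable_add summable_mult summable_geometric summable_If_finite_set) auto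
  have P: "P \<ge> 0" by (simp add: P_def)
  show thesis
  proof (rule that[of "suminf d"])
    fix s assume s: "D < Re s" "Re s \<le> D + 1" "Im s = \<tau>"
    let ?m = "\<lambda>n. of_real (lacunary_weight n) * exp (of_real D - s) ^ n"
    let ?I = "\<lambda>n. \<integral>x. shell_zeta_integrand D T s n x \<partial>lebesgue"
    have "norm (exp (of_real D - s)) < 1" using s by (simp add: norm_exp_eq_Re)
    hence "?m sums suminf ?m" by (intro summable_sums summable_lacunary_series)
    hence "(\<lambda>n. ?I n - ?m n) sums (distance_zeta_inf T (shell_union D) s - suminf ?m)"
      by (intro sums_diff distance_zeta_shell_union_sums D s)
    hence "distance_zeta_inf T (shell_union D) s - suminf ?m = (\<Sum>n. ?I n - ?m n)" by (simp add: sums_iff)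
    also have "norm \<dots> \<le> suminf d"
    proof (rule norm_suminf_le[OF _ \<open>summable d\<close>])
      fix n
      have pow: "2 powr \<bar>Re s + 2\<bar> \<le> P" "2 powr \<bar>Re s + 3\<bar> \<le> P"
        unfolding P_def using s by (intro powr_mono; simp; linarith)+
      show "norm (?I n - ?m n) \<le> d n"
      proof (cases "exp (real n) < T")
        case True
        have "norm (?I n - ?m n) \<le> 2 * (2 powr \<bar>Re s + 2\<bar> + 1)"
          using s by (intro shell_zeta_error_crude D) auto
        also have "\<dots> \<le> 2 * (P + 1)" using pow by simp
        also have "\<dots> \<le> d n" using True P by (simp add: d_def)
        finally show ?thesis .
      next
        case False
        have "norm (s + 2) \<le> \<bar>Re (s + 2)\<bar> + \<bar>Im (s + 2)\<bar>" by (rule cmod_le)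
        hence "norm (s + 2) \<le> \<bar>D\<bar> + \<bar>\<tau>\<bar> + 3" using s by simp
        hence "4 * norm (s + 2) * 2 powr \<bar>Re s + 3\<bar> * exp D ^ n \<le> 4 * (\<bar>D\<bar> + \<bar>\<tau>\<bar> + 3) * P * exp D ^ n"
          using pow(2) by (intro mult_right_mono mult_mono) auto
        moreover have "norm (?I n - ?m n) \<le> 4 * norm (s + 2) * 2 powr \<bar>Re s + 3\<bar> * exp D ^ n"
          using s False by (intro shell_zeta_error_fine D) auto
        ultimately have "norm (?I n - ?m n) \<le> 4 * (\<bar>D\<bar> + \<bar>\<tau>\<bar> + 3) * P * exp D ^ n" by linarith
        thus ?thesis using False by (simp add: d_def)
      qed
    qed
    finally show "norm (distance_zeta_inf T (shell_union D) s - suminf ?m) \<le> suminf d" .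
  qed
qed

section \<open>Singular behaviour on a dense subset of the critical line\<close>

text \<open>Rounding \<open>\<theta>\<close> down to a multiple of \<open>2 * pi / 2 ^ K\<close> for large \<open>K\<close>.\<close>
lemma dyadic_angle_dense:
  fixes \<theta> \<epsilon> :: real
  assumes "\<epsilon> > 0"
  obtains \<tau> :: real and K :: nat where "\<bar>\<tau> - \<theta>\<bar> < \<epsilon>" "cis (- \<tau>) ^ (2 ^ K) = 1"
proof -
  obtain K where K: "2 * pi / \<epsilon> < 2 ^ K" using real_arch_pow[of 2 "2 * pi / \<epsilon>"] by auto
  define j where "j = \<lfloor>\<theta> * 2 ^ K / (2 * pi)\<rfloor>"
  define \<tau> where "\<tau> = 2 * pi * of_int j / 2 ^ K"
  have "\<bar>\<tau> - \<theta>\<bar> \<le> 2 * pi / 2 ^ K"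
  proof -
    have "\<tau> - \<theta> = (2 * pi / 2 ^ K) * (of_int j - \<theta> * 2 ^ K / (2 * pi))"
      by (simp add: \<tau>_def field_simps)
    moreover have "\<bar>of_int j - \<theta> * 2 ^ K / (2 * pi)\<bar> \<le> 1" unfolding j_def by linarith
    ultimately show ?thesis
      using mult_left_mono[of "\<bar>of_int j - \<theta> * 2 ^ K / (2 * pi)\<bar>" 1 "2 * pi / 2 ^ K"]
      by (simp add: abs_mult)
  qed
  also have "\<dots> < \<epsilon>" using K assms by (simp add: field_simps)
  finally have "\<bar>\<tau> - \<theta>\<bar> < \<epsilon>" .
  moreover have "cis (- \<tau>) ^ (2 ^ K) = 1"
  proof -
    have "cis (- \<tau>) ^ (2 ^ K) = cis (2 * pi * of_int (- j))"
      unfolding \<tau>_def Complex.DeMoivre by simp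
    thus ?thesis by (simp only: cis_multiple_2pi[OF Ints_of_int])
  qed
  ultimately show thesis by (rule that)
qed

text \<open>Moving horizontally towards the critical line, \<open>w = exp (D - s)\<close> runs along the radius
  ending at \<open>cis (- \<tau>)\<close>, so the divergence of the lacunary series there is inherited up to a
  bounded error.\<close>
lemma distance_zeta_shell_union_blow_up:
  assumes D: "D < -2" and z: "cis (- \<tau>) ^ (2 ^ K) = 1"
  shows "filterlim (\<lambda>\<delta>. Re (distance_zeta_inf T (shell_union D) (Complex (D + \<delta>) \<tau>))) at_top (at_right 0)"
proof -
  let ?S = "\<lambda>w. \<Sum>n. of_real (lacunary_weight n) * w ^ n :: complex"
  obtain M where M: "\<And>s. D < Re s \<Longrightarrow> Re s \<le> D + 1 \<Longrightarrow> Im s = \<tau> \<Longrightarrow>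
    norm (distance_zeta_inf T (shell_union D) s - ?S (exp (of_real D - s))) \<le> M"
    using distance_zeta_shell_union_lacunary[OF D, of \<tau> T] by blast
  have "((\<lambda>\<delta>::real. exp (- \<delta>)) \<longlongrightarrow> exp (- 0)) (at_right 0)" by (intro tendsto_intros)
  moreover have "eventually (\<lambda>\<delta>::real. exp (- \<delta>) \<in> {..<1} - {1}) (at_right 0)"
    by (simp add: eventually_at_filter)
  ultimately have "filterlim (\<lambda>\<delta>::real. exp (- \<delta>)) (at_left 1) (at_right 0)"
    unfolding filterlim_at by (auto elim: eventually_mono)
  from filterlim_compose[OF lacunary_series_at_top[OF z] this]
  have main: "filterlim (\<lambda>\<delta>. Re (?S (cis (- \<tau>) * of_real (exp (- \<delta>))))) at_top (at_right 0)" .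
  have "filterlim (\<lambda>\<delta>. - M + Re (?S (cis (- \<tau>) * of_real (exp (- \<delta>))))) at_top (at_right 0)"
    by (rule filterlim_tendsto_add_at_top[OF tendsto_const main])
  moreover have "eventually (\<lambda>\<delta>. - M + Re (?S (cis (- \<tau>) * of_real (exp (- \<delta>))))
      \<le> Re (distance_zeta_inf T (shell_union D) (Complex (D + \<delta>) \<tau>))) (at_right 0)"
    using eventually_at_right_real[of 0 "1::real", OF zero_less_one]
  proof eventually_elim
    case (elim \<delta>)
    let ?s = "Complex (D + \<delta>) \<tau>"
    have "exp (of_real D - ?s) = cis (- \<tau>) * of_real (exp (- \<delta>))"
      by (simp add: complex_eq_iff Re_exp Im_exp)
    with M[of ?s] elim have "norm (distance_zeta_inf T (shell_union D) ?s
        - ?S (cis (- \<tau>) * of_real (exp (- \<delta>)))) \<le> M" by simp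
    thus ?case using abs_Re_le_cmod[of "distance_zeta_inf T (shell_union D) ?s
        - ?S (cis (- \<tau>) * of_real (exp (- \<delta>)))"] by simp
  qed
  ultimately show ?thesis by (rule filterlim_at_top_mono)
qed

theorem theorem5p3:
  fixes D :: real
  assumes "D < -2"
  shows "\<exists>\<Omega> :: (real ^ 2) set.
           \<Omega> \<in> sets lebesgue \<and> emeasure lebesgue \<Omega> < \<infinity> \<and>
           (\<forall>T>0. maximally_hyperfractal_inf T \<Omega>) \<and>
           has_minkowski_dim_inf \<Omega> (ereal D) \<and>
           minkowski_nondegenerate_inf \<Omega>"
proof (intro exI conjI allI impI)
  let ?\<Omega> = "shell_union D"
  show "?\<Omega> \<in> sets lebesgue"
    unfolding shell_union_def using shell_sets by (intro sets.countable_UN) auto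
  have ge1: "1 \<le> norm x" if "x \<in> shell D n" for x n
    using that order_trans[of 1 "exp (real n)" "norm x"] by (simp add: shell_def)
  have "tail_at_infinity 1 ?\<Omega> = ?\<Omega>"
    by (auto simp: tail_at_infinity_def shell_union_def dest: ge1)
  with tail_shell_union_emeasure_bounds(2)[OF assms, of 1]
  show "emeasure lebesgue ?\<Omega> < \<infinity>" by (simp add: order_le_less_trans del: emeasure_completion)
  have "0 \<le> 2 * exp (- (2 + D)) / (1 - exp (2 + D))" using assms by simp
  note dims = powr_tail_bounds_imp_minkowski_dim_inf[of "exp (2 + D)", OF _ this, of D ?\<Omega>]
  show dim: "has_minkowski_dim_inf ?\<Omega> (ereal D)" and "minkowski_nondegenerate_inf ?\<Omega>"
    using dims tail_shell_union_emeasure_bounds[OF assms] by simp_all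
  fix T :: real
  show "maximally_hyperfractal_inf T ?\<Omega>"
    unfolding maximally_hyperfractal_inf_def
  proof (intro exI conjI allI impI notI)
    show "upper_minkowski_dim_inf ?\<Omega> = ereal D" using dim by (simp add: has_minkowski_dim_inf_def)
    fix s0 :: complex
    assume s0: "Re s0 = D" and "\<exists>U g. open U \<and> s0 \<in> U \<and> g holomorphic_on U \<and>
      (\<forall>s\<in>U. Re s > D \<longrightarrow> g s = distance_zeta_inf T ?\<Omega> s)"
    then obtain U g where U: "open U" "s0 \<in> U" and g: "g holomorphic_on U"
      and eq: "\<And>s. s \<in> U \<Longrightarrow> Re s > D \<Longrightarrow> g s = distance_zeta_inf T ?\<Omega> s" by blast
    obtain \<epsilon> where \<epsilon>: "\<epsilon> > 0" "ball s0 \<epsilon> \<subseteq> U" using U open_contains_ball by blast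
    obtain \<tau> K where \<tau>: "\<bar>\<tau> - Im s0\<bar> < \<epsilon>" and K: "cis (- \<tau>) ^ (2 ^ K) = 1"
      using dyadic_angle_dense[OF \<epsilon>(1)] by blast
    define s1 where "s1 = Complex D \<tau>"
    have "dist s0 s1 = \<bar>\<tau> - Im s0\<bar>"
      using s0 by (simp add: s1_def dist_norm cmod_def abs_minus_commute)
    hence "s1 \<in> U" using \<tau> \<epsilon>(2) by auto
    have path: "((\<lambda>\<delta>. Complex (D + \<delta>) \<tau>) \<longlongrightarrow> s1) (at_right 0)"
    proof -
      have "((\<lambda>\<delta>. Complex (D + \<delta>) \<tau>) \<longlongrightarrow> Complex (D + 0) \<tau>) (at_right 0)"
        by (intro tendsto_intros)
      thus ?thesis by (simp add: s1_def)
    qed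
    have "isCont g s1"
      using holomorphic_on_imp_continuous_on[OF g] U(1) \<open>s1 \<in> U\<close> by (simp add: continuous_on_eq_continuous_at)
    hence "((\<lambda>\<delta>. Re (g (Complex (D + \<delta>) \<tau>))) \<longlongrightarrow> Re (g s1)) (at_right 0)"
      by (intro tendsto_Re isCont_tendsto_compose[OF _ path])
    moreover have "eventually (\<lambda>\<delta>. Re (g (Complex (D + \<delta>) \<tau>))
        = Re (distance_zeta_inf T ?\<Omega> (Complex (D + \<delta>) \<tau>))) (at_right 0)"
      using topological_tendstoD[OF path U(1) \<open>s1 \<in> U\<close>] eventually_at_right_less[of 0]
      by eventually_elim (simp add: eq)
    ultimately have "((\<lambda>\<delta>. Re (distance_zeta_inf T ?\<Omega> (Complex (D + \<delta>) \<tau>))) \<longlongrightarrow> Re (g s1)) (at_right 0)"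
      by (rule Lim_transform_eventually)
    from not_tendsto_and_filterlim_at_infinity[OF _ this
        filterlim_at_top_imp_at_infinity[OF distance_zeta_shell_union_blow_up[OF assms K]]]
    show False by simp
  qed
qed

end
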